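(* Let $E$, $F$, $G$ be Fréchet spaces. The triple $(E,G,F)$ has the tame factorization property if and only if there exists a nondecreasing function $S:\mathbb{N}\to\mathbb{N}$ such that for every function $\phi:\mathbb{N}\to\mathbb{N}$ the following holds: there exists $k_0\in\mathbb{N}$ such that for every $k\ge k_0$ there exist $q_k\in\mathbb{N}$ and $C_k>0$ with $$\|T\|_{k,S(k)}\le C_k\,\max_{1\le q\le q_k}\|R\|_{q,\phi(q)}\,\max_{1\le q\le q_k}\|Q\|_{q,\phi(q)}$$ for every $Q\in L_\phi(E,G)$ and every $R\in L_\phi(G,F)$, where $T=RQ$.
   Context: $\mathbb{N}=\{1,2,3,\dots\}$. Every Fréchet space is equipped with a fixed grading, i.e. an increasing sequence of seminorms $(\|\cdot\|_k)_{k\in\mathbb{N}}$ defining its topology. $L(E,F)$ is the space of continuous linear operators $E\to F$. For $T\in L(E,F)$ and $k,r\in\mathbb{N}$ put $\|T\|_{k,r}=\sup_{\|x\|_r\le 1}\|Tx\|_k\in[0,\infty]$, and $\pi_T(k)=\inf\{r\in\mathbb{N}:\|T\|_{k,r}<\infty\}$. For $\phi:\mathbb{N}\to\mathbb{N}$, $L_\phi(E,F)=\{T\in L(E,F):\|T\|_{k,\phi(k)}<\infty\text{ for all }k\in\mathbb{N}\}$. $L^G(E,F)$ is the set of all $T\in L(E,F)$ of the form $T=RQ$ with $Q\in L(E,G)$ and $R\in L(G,F)$. The triple $(E,G,F)$ has the tame factorization property, written $(E,G,F)\in\mathfrak{TF}$, if there is a nondecreasing $S:\mathbb{N}\to\mathbb{N}$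 such that for every $T\in L^G(E,F)$ there is $k_0\in\mathbb{N}$ with $\pi_T(k)\le S(k)$ for all $k\ge k_0$. *)

theory Defs
  imports "HOL-Analysis.Analysis"
begin

text \<open>
  The natural numbers are \<open>{1, 2, 3, \<dots>}\<close> throughout, written \<open>{1::nat..}\<close>; in particular
  \<open>snorm E 0\<close> is junk, on which nothing below depends.

  The scalar field is an arbitrary \<^class>\<open>real_normed_field\<close>. As the norm of this class is
  multiplicative, the only instances up to isometric isomorphism are the real and the complex
  numbers, so both real and complex spaces are covered.
\<close>

record ('k, 'v) graded_space =
  scal :: "'k \<Rightarrow> 'v \<Rightarrow> 'v"
  snorm :: "nat \<Rightarrow> 'v \<Rightarrow> real"

definition seminorm :: "('k::real_normed_field \<Rightarrow> 'v::ab_group_add \<Rightarrow> 'v) \<Rightarrow> ('v \<Rightarrow> real) \<Rightarrow> bool"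
  where "seminorm s p \<longleftrightarrow>
    (\<forall>x. 0 \<le> p x) \<and> (\<forall>x y. p (x + y) \<le> p x + p y) \<and> (\<forall>c x. p (s c x) = norm c * p x)"

definition grading_topology :: "('k, 'v::ab_group_add) graded_space \<Rightarrow> 'v topology"
  where "grading_topology E =
    topology_generated_by {{y. snorm E k (y - x) < \<epsilon>} | k x \<epsilon>. 1 \<le> k \<and> 0 < \<epsilon>}"

definition grading_Cauchy :: "('k, 'v::ab_group_add) graded_space \<Rightarrow> (nat \<Rightarrow> 'v) \<Rightarrow> bool"
  where "grading_Cauchy E X \<longleftrightarrow>
    (\<forall>k\<ge>1. \<forall>\<epsilon>>0. \<exists>N. \<forall>m\<ge>N. \<forall>n\<ge>N. snorm E k (X m - X n) < \<epsilon>)"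

text \<open>
  The topology is metrizable, having countably many seminorms, so completeness is a statement
  about sequences.
\<close>

definition frechet_space :: "('k::real_normed_field, 'v::ab_group_add) graded_space \<Rightarrow> bool"
  where "frechet_space E \<longleftrightarrow>
    vector_space (scal E) \<and>
    (\<forall>k\<ge>1. seminorm (scal E) (snorm E k)) \<and>
    (\<forall>k\<ge>1. \<forall>x. snorm E k x \<le> snorm E (Suc k) x) \<and>
    Hausdorff_space (grading_topology E) \<and>
    (\<forall>X. grading_Cauchy E X \<longrightarrow> (\<exists>l. limitin (grading_topology E) X l sequentially))"

definition cont_ops ::
    "('k::real_normed_field, 'e::ab_group_add) graded_space \<Rightarrow>
     ('k, 'f::ab_group_add) graded_space \<Rightarrow> ('e \<Rightarrow> 'f) set"
  where "cont_ops E F =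
    {T. Vector_Spaces.linear (scal E) (scal F) T \<and>
        continuous_map (grading_topology E) (grading_topology F) T}"

definition op_norm ::
    "('k, 'e) graded_space \<Rightarrow> ('k, 'f) graded_space \<Rightarrow> ('e \<Rightarrow> 'f) \<Rightarrow> nat \<Rightarrow> nat \<Rightarrow> ennreal"
  where "op_norm E F T k r = (SUP x\<in>{x. snorm E r x \<le> 1}. ennreal (snorm F k (T x)))"

text \<open>
  For a continuous operator the set below is nonempty, so the infimum is a minimum and the
  value of \<^const>\<open>Inf\<close> on the empty set of naturals does not matter.
\<close>

definition cont_char ::
    "('k, 'e) graded_space \<Rightarrow> ('k, 'f) graded_space \<Rightarrow> ('e \<Rightarrow> 'f) \<Rightarrow> nat \<Rightarrow> nat"
  where "cont_char E F T k = Inf {r. 1 \<le> r \<and> op_norm E F T k r < \<infinity>}"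

definition cont_ops_bounded ::
    "(nat \<Rightarrow> nat) \<Rightarrow> ('k::real_normed_field, 'e::ab_group_add) graded_space \<Rightarrow>
     ('k, 'f::ab_group_add) graded_space \<Rightarrow> ('e \<Rightarrow> 'f) set"
  where "cont_ops_bounded \<phi> E F =
    {T \<in> cont_ops E F. \<forall>k\<ge>1. op_norm E F T k (\<phi> k) < \<infinity>}"

definition cont_ops_through ::
    "('k::real_normed_field, 'g::ab_group_add) graded_space \<Rightarrow>
     ('k, 'e::ab_group_add) graded_space \<Rightarrow> ('k, 'f::ab_group_add) graded_space \<Rightarrow>
     ('e \<Rightarrow> 'f) set"
  where "cont_ops_through G E F =
    {T \<in> cont_ops E F. \<exists>Q\<in>cont_ops E G. \<exists>R\<in>cont_ops G F. T = R \<circ> Q}"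

definition tame_factorization ::
    "('k::real_normed_field, 'e::ab_group_add) graded_space \<Rightarrow>
     ('k, 'g::ab_group_add) graded_space \<Rightarrow> ('k, 'f::ab_group_add) graded_space \<Rightarrow> bool"
  where "tame_factorization E G F \<longleftrightarrow>
    (\<exists>S \<in> {1..} \<rightarrow> {1..}. mono_on {1..} S \<and>
      (\<forall>T\<in>cont_ops_through G E F. \<exists>k0\<ge>1. \<forall>k\<ge>k0. cont_char E F T k \<le> S k))"

end

theory Submission
  imports Defs
begin

text \<open>
  By monotonicity of \<open>r \<mapsto> \<parallel>T\<parallel>\<^sub>k\<^sub>,\<^sub>r\<close>, the inequality \<open>\<pi>\<^sub>T(k) \<le> S(k)\<close> says that \<open>\<parallel>T\<parallel>\<close> at
  \<open>(k, S(k))\<close> is finite. Given \<open>Q\<close> and \<open>R\<close>, a single \<open>\<phi>\<close> serves both, and the bound at \<open>\<phi>\<close> makes this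
  norm of \<open>RQ\<close> finite for large \<open>k\<close>. Conversely, \<open>X = L\<^sub>\<phi>(E,G) \<times> L\<^sub>\<phi>(G,F)\<close> is a Frechet space for the
  seminorms \<open>\<parallel>\<cdot>\<parallel>\<close> at \<open>(q, \<phi>(q))\<close>. If no bound holds at \<open>k\<close>, then for every \<open>n\<close> the pairs for which the
  norm of \<open>RQ\<close> at \<open>(k, S(k))\<close> exceeds \<open>n\<close> form an open dense subset of \<open>X\<close>. By Baire's theorem one pair
  \<open>(Q, R)\<close> therefore has infinite norm at \<open>(k, S(k))\<close> for all such \<open>k\<close> simultaneously, so tameness of
  this one product leaves only finitely many of them.
\<close>

section \<open>Baire category for an increasing sequence of pseudometrics\<close>

text \<open>Let \<open>a'\<close> decrease to \<open>a\<close>. This serves estimates that divide by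
  a seminorm or an operator norm which may vanish: a strictly larger \<open>a'\<close> is
  positive.\<close>

lemma le_mult_of_all_greater:
  fixes y a c :: real
  assumes "\<And>a'. a < a' \<Longrightarrow> y \<le> c * a'"
  shows "y \<le> c * a"
proof (rule tendsto_lowerbound)
  show "((\<lambda>t. c * t) \<longlongrightarrow> c * a) (at_right a)"
    by (intro tendsto_intros)
  show "\<forall>\<^sub>F t in at_right a. y \<le> c * t"
    using assms by (auto simp: eventually_at_filter)
qed simp

text \<open>Nested balls with levels tending to infinity and radii tending to zero; their centres
  form a Cauchy sequence whose limit lies in every \<open>U n\<close>. Working with pseudometrics on
  a carrier set applies directly to a space given by seminorms, with no single metric to be
  built.\<close>

lemma baire_pseudometrics:
  fixes p :: "nat \<Rightarrow> 'a \<Rightarrow> 'a \<Rightarrow> real" and U :: "nat \<Rightarrow> 'a set"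
  assumes "X \<noteq> {}"
    and refl: "\<And>m x. x \<in> X \<Longrightarrow> p m x x = 0"
    and sym: "\<And>m x y. x \<in> X \<Longrightarrow> y \<in> X \<Longrightarrow> p m x y = p m y x"
    and tri: "\<And>m x y z. x \<in> X \<Longrightarrow> y \<in> X \<Longrightarrow> z \<in> X \<Longrightarrow> p m x z \<le> p m x y + p m y z"
    and mono: "\<And>l m x y. x \<in> X \<Longrightarrow> y \<in> X \<Longrightarrow> l \<le> m \<Longrightarrow> p l x y \<le> p m x y"
    and complete: "\<And>u :: nat \<Rightarrow> 'a. range u \<subseteq> X \<Longrightarrow>
      (\<And>m \<epsilon>. 0 < \<epsilon> \<Longrightarrow> \<exists>N. \<forall>i\<ge>N. \<forall>j\<ge>N. p m (u i) (u j) < \<epsilon>) \<Longrightarrow>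
      \<exists>l\<in>X. \<forall>m. \<forall>\<epsilon>>0. \<exists>N. \<forall>i\<ge>N. p m (u i) l < \<epsilon>"
    and sub: "\<And>n. U n \<subseteq> X"
    and opens: "\<And>n x. x \<in> U n \<Longrightarrow> \<exists>m. \<exists>\<epsilon>>0. \<forall>y\<in>X. p m x y < \<epsilon> \<longrightarrow> y \<in> U n"
    and dense: "\<And>n x m \<epsilon>. x \<in> X \<Longrightarrow> 0 < \<epsilon> \<Longrightarrow> \<exists>y\<in>U n. p m x y < \<epsilon>"
  shows "\<exists>x\<in>X. \<forall>n. x \<in> U n"
proof -
  \<comment> \<open>A triple is a ball: centre, level and radius. \<open>P n\<close> bounds its size
    at stage \<open>n\<close>; \<open>Q n\<close> says that the next ball lies in \<open>U n\<close>
    and in the concentric ball of half the radius.\<close>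
  define P where "P = (\<lambda>(n::nat) (x, m::nat, \<epsilon>::real). x \<in> X \<and> 0 < \<epsilon> \<and> \<epsilon> \<le> (1/2)^n \<and> n \<le> m)"
  define Q where "Q = (\<lambda>(n::nat) (x, m, \<epsilon>) (x', m', \<epsilon>').
     (\<forall>y\<in>X. p m' x' y < \<epsilon>' \<longrightarrow> y \<in> U n \<and> p m x y < \<epsilon> / 2))"
  have "\<exists>s. \<forall>n. P n (s n) \<and> Q n (s n) (s (Suc n))"
  proof (rule dependent_nat_choice)
    from \<open>X \<noteq> {}\<close> obtain x where "x \<in> X" by auto
    then have "P 0 (x, 0, 1)" by (simp add: P_def)
    then show "\<exists>s. P 0 s" ..
  next
    fix s n assume Ps: "P n s"
    obtain x m \<epsilon> where s: "s = (x, m, \<epsilon>)" by (cases s)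
    with Ps have x: "x \<in> X" and \<epsilon>: "0 < \<epsilon>" "\<epsilon> \<le> (1/2)^n" "n \<le> m" by (auto simp: P_def)
    \<comment> \<open>A centre within \<open>\<epsilon> / 4\<close> and a new radius of at most
      \<open>\<epsilon> / 4\<close> keep the new ball inside the half ball.\<close>
    obtain z where z: "z \<in> U n" "p m x z < \<epsilon> / 4" using dense[OF x, of "\<epsilon> / 4"] \<epsilon> by auto
    then have zX: "z \<in> X" using sub by auto
    obtain l \<delta> where l: "0 < \<delta>" "\<And>y. y \<in> X \<Longrightarrow> p l z y < \<delta> \<Longrightarrow> y \<in> U n"
      using opens[OF z(1)] by blast
    define m' where "m' = max l (Suc m)"
    define \<epsilon>' where "\<epsilon>' = min \<delta> (\<epsilon> / 4)"
    have "P (Suc n) (z, m', \<epsilon>')"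
      using zX \<epsilon> l(1) by (auto simp: P_def m'_def \<epsilon>'_def)
    moreover have "Q n s (z, m', \<epsilon>')"
      unfolding Q_def s prod.case
    proof (intro ballI impI conjI)
      fix y assume y: "y \<in> X" "p m' z y < \<epsilon>'"
      have "p l z y \<le> p m' z y" "p m z y \<le> p m' z y"
        using mono[OF zX y(1)] by (auto simp: m'_def)
      with y have "p l z y < \<delta>" "p m z y < \<epsilon> / 4" by (auto simp: \<epsilon>'_def)
      then show "y \<in> U n" "p m x y < \<epsilon> / 2"
        using l(2) y tri[OF x zX y(1), of m] z(2) by auto
    qed
    ultimately show "\<exists>s'. P (Suc n) s' \<and> Q n s s'" by blast
  qed
  then obtain s where s: "\<And>n. P n (s n)" "\<And>n. Q n (s n) (s (Suc n))" by blast
  define u m \<epsilon> where "u = (\<lambda>n. fst (s n))" and "m = (\<lambda>n. fst (snd (s n)))"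
    and "\<epsilon> = (\<lambda>n. snd (snd (s n)))"
  have uX: "u n \<in> X" and eps: "0 < \<epsilon> n" "\<epsilon> n \<le> (1/2)^n" and mn: "n \<le> m n" for n
    using s(1)[of n] by (auto simp: P_def u_def m_def \<epsilon>_def split: prod.splits)
  have nest: "y \<in> U n" "p (m n) (u n) y < \<epsilon> n / 2"
    if "y \<in> X" "p (m (Suc n)) (u (Suc n)) y < \<epsilon> (Suc n)" for y n
    using s(2)[of n] that by (auto simp: Q_def u_def m_def \<epsilon>_def split: prod.splits)
  \<comment> \<open>By induction with \<open>n\<close> generalised, \<open>u (Suc n + j)\<close>
    lies in the ball of index \<open>Suc n\<close>, hence in the half ball of index
    \<open>n\<close>.\<close>
  have tail: "p (m n) (u n) (u (n + j)) < \<epsilon> n" for n j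
  proof (induction j arbitrary: n)
    case 0
    then show ?case using refl uX eps by simp
  next
    case (Suc j)
    have "p (m n) (u n) (u (Suc n + j)) < \<epsilon> n / 2"
      using nest(2)[OF uX Suc[of "Suc n"]] .
    then show ?case using eps(1)[of n] by simp
  qed
  have "\<exists>N. \<forall>i\<ge>N. \<forall>j\<ge>N. p k (u i) (u j) < e" if e: "0 < e" for k and e :: real
  proof -
    obtain n0 where n0: "(1/2::real)^n0 < e / 2"
      using real_arch_pow_inv[of "e/2" "1/2"] e by auto
    \<comment> \<open>\<open>N \<ge> k\<close> gives \<open>m N \<ge> k\<close>, so
      \<open>p k\<close> is dominated by the pseudometric in which the \<open>N\<close>-th ball is
      measured.\<close>
    define N where "N = max k n0"
    have "(1/2::real)^N \<le> (1/2)^n0" by (intro power_decreasing) (auto simp: N_def)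
    then have eN: "\<epsilon> N < e / 2" using eps(2)[of N] n0 by linarith
    have "p k (u N) (u i) < e / 2" if "i \<ge> N" for i
    proof -
      have "p k (u N) (u i) \<le> p (m N) (u N) (u i)"
        using mono uX mn[of N] by (auto simp: N_def)
      also have "\<dots> < \<epsilon> N" using tail[of N "i - N"] that by simp
      finally show ?thesis using eN by simp
    qed
    then have "p k (u i) (u j) < e" if "i \<ge> N" "j \<ge> N" for i j
      using tri[OF uX[of i] uX[of N] uX[of j], of k] sym[OF uX[of i] uX[of N], of k] that
      by (smt (verit) field_sum_of_halves)
    then show ?thesis by blast
  qed
  then obtain l where l: "l \<in> X" "\<And>k e. 0 < e \<Longrightarrow> \<exists>N. \<forall>i\<ge>N. p k (u i) l < e"
    using complete[of u] uX by blast
  have "l \<in> U n" for n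
  proof -
    \<comment> \<open>Membership in \<open>U n\<close> is read off from the ball of index
      \<open>Suc n\<close>. Late centres lie within half its radius, which leaves the other half for
      the distance to the limit \<open>l\<close>.\<close>
    let ?n = "Suc n" let ?k = "m (Suc n)"
    obtain N where N: "\<And>i. i \<ge> N \<Longrightarrow> p (m (Suc ?n)) (u i) l < \<epsilon> ?n / 2"
      using l(2)[of "\<epsilon> ?n / 2"] eps(1)[of ?n] by auto
    obtain N2 where N2: "\<And>i. i \<ge> N2 \<Longrightarrow> p ?k (u i) l < \<epsilon> ?n / 2"
      using l(2)[of "\<epsilon> ?n / 2"] eps(1)[of ?n] by auto
    define i where "i = Suc ?n + N2"
    have "p (m (Suc ?n)) (u (Suc ?n)) (u i) < \<epsilon> (Suc ?n)"
      unfolding i_def by (rule tail)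
    from nest(2)[OF uX this] have "p ?k (u ?n) (u i) < \<epsilon> ?n / 2" .
    moreover have "p ?k (u i) l < \<epsilon> ?n / 2" by (rule N2) (simp add: i_def)
    ultimately have "p ?k (u ?n) l < \<epsilon> ?n"
      using tri[OF uX[of ?n] uX[of i] l(1), of ?k] by simp
    then show ?thesis using nest(1)[OF l(1)] by blast
  qed
  with l(1) show ?thesis by blast
qed

section \<open>Topology of a graded Frechet space in terms of its seminorms\<close>

locale frechet =
  fixes E :: "('k::real_normed_field, 'e::ab_group_add) graded_space"
  assumes frechet: "frechet_space E"
begin

sublocale vector_space "scal E"
  using frechet by (simp add: frechet_space_def)

lemma
  assumes "1 \<le> k"
  shows snorm_nonneg: "0 \<le> snorm E k x"
    and snorm_triangle: "snorm E k (x + y) \<le> snorm E k x + snorm E k y"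
    and snorm_scale: "snorm E k (scal E c x) = norm c * snorm E k x"
  using frechet assms by (auto simp: frechet_space_def seminorm_def)

lemma snorm_zero: "1 \<le> k \<Longrightarrow> snorm E k 0 = 0"
  using snorm_scale[of k 0 0] by simp

lemma snorm_minus: "1 \<le> k \<Longrightarrow> snorm E k (- x) = snorm E k x"
  using snorm_scale[of k "-1" x] by simp

lemma snorm_diff_triangle:
  "1 \<le> k \<Longrightarrow> snorm E k (x - z) \<le> snorm E k (x - y) + snorm E k (y - z)"
  using snorm_triangle[of k "x - y" "y - z"] by simp

lemma snorm_diff_le: "1 \<le> k \<Longrightarrow> snorm E k (x - y) \<le> snorm E k x + snorm E k y"
  using snorm_diff_triangle[of k x y 0] snorm_minus[of k y] by simp

lemma snorm_mono:
  assumes k: "1 \<le> k" and "k \<le> r"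
  shows "snorm E k x \<le> snorm E r x"
  using \<open>k \<le> r\<close>
proof (induction r rule: dec_induct)
  case (step n)
  then have "snorm E n x \<le> snorm E (Suc n) x"
    using frechet k by (simp add: frechet_space_def)
  with step show ?case by simp
qed simp

lemma openin_ball:
  assumes "1 \<le> k" "0 < \<epsilon>"
  shows "openin (grading_topology E) {y. snorm E k (y - x) < \<epsilon>}"
  unfolding grading_topology_def using assms by (intro topology_generated_by_Basis) blast

text \<open>By definition the balls are only a subbasis. As the seminorms increase, balls at levels
  \<open>k\<close> and \<open>l\<close> around a point contain one at level \<open>max k l\<close>,
  and the triangle inequality recentres a ball at any of its points.\<close>

lemma openin_grading_topology_iff:
  "openin (grading_topology E) U \<longleftrightarrow>
    (\<forall>x\<in>U. \<exists>k\<ge>1. \<exists>\<epsilon>>0. \<forall>y. snorm E k (y - x) < \<epsilon> \<longrightarrow> y \<in> U)" (is "_ \<longleftrightarrow> ?R U")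
proof
  assume "openin (grading_topology E) U"
  then have "generate_topology_on {{y. snorm E k (y - x) < \<epsilon>} | k x \<epsilon>. 1 \<le> k \<and> 0 < \<epsilon>} U"
    by (simp add: grading_topology_def openin_topology_generated_by_iff)
  then show "?R U"
  proof induction
    case (Int U V)
    show ?case
    proof
      fix x assume x: "x \<in> U \<inter> V"
      obtain k \<epsilon> where k: "k \<ge> 1" "\<epsilon> > 0" "\<And>y. snorm E k (y - x) < \<epsilon> \<Longrightarrow> y \<in> U"
        using Int x by blast
      obtain l \<delta> where l: "l \<ge> 1" "\<delta> > 0" "\<And>y. snorm E l (y - x) < \<delta> \<Longrightarrow> y \<in> V"
        using Int x by blast
      have "y \<in> U \<inter> V" if "snorm E (max k l) (y - x) < min \<epsilon> \<delta>" for y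
        using that k l snorm_mono[of k "max k l" "y - x"] snorm_mono[of l "max k l" "y - x"]
        by auto
      then show "\<exists>k\<ge>1. \<exists>\<epsilon>>0. \<forall>y. snorm E k (y - x) < \<epsilon> \<longrightarrow> y \<in> U \<inter> V"
        using k l by (intro exI[of _ "max k l"] conjI exI[of _ "min \<epsilon> \<delta>"]) auto
    qed
  next
    case (UN K)
    then show ?case by (meson UnionE UnionI)
  next
    case (Basis s)
    then obtain k z \<epsilon> where s: "s = {y. snorm E k (y - z) < \<epsilon>}" "1 \<le> k" "0 < \<epsilon>" by blast
    show ?case
    proof
      fix x assume "x \<in> s"
      then have "0 < \<epsilon> - snorm E k (x - z)" using s by simp
      moreover have "y \<in> s" if "snorm E k (y - x) < \<epsilon> - snorm E k (x - z)" for y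
        using that snorm_diff_triangle[OF s(2), of y z x] s(1) by simp
      ultimately show "\<exists>k\<ge>1. \<exists>\<epsilon>>0. \<forall>y. snorm E k (y - x) < \<epsilon> \<longrightarrow> y \<in> s"
        using s(2) by blast
    qed
  qed simp
next
  assume R: "?R U"
  show "openin (grading_topology E) U"
  proof (subst openin_subopen, intro ballI)
    fix x assume "x \<in> U"
    then obtain k \<epsilon> where k: "k \<ge> 1" "\<epsilon> > 0" "\<And>y. snorm E k (y - x) < \<epsilon> \<Longrightarrow> y \<in> U"
      using R by blast
    then show "\<exists>T. openin (grading_topology E) T \<and> x \<in> T \<and> T \<subseteq> U"
      using openin_ball[OF k(1,2), of x] snorm_zero[of k]
      by (intro exI[of _ "{y. snorm E k (y - x) < \<epsilon>}"]) auto
  qed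
qed

lemma topspace_grading_topology: "topspace (grading_topology E) = UNIV"
proof -
  have "openin (grading_topology E) UNIV"
    unfolding openin_grading_topology_iff by (auto intro: exI[of _ 1])
  then show ?thesis using openin_subset by blast
qed

text \<open>If all seminorms of \<open>x\<close> vanish, every neighbourhood of \<open>x\<close>
  contains 0, against the Hausdorff property.\<close>

lemma eq_zeroI:
  assumes "\<And>k. 1 \<le> k \<Longrightarrow> snorm E k x = 0"
  shows "x = 0"
proof (rule ccontr)
  assume "x \<noteq> 0"
  then obtain U V where U: "openin (grading_topology E) U" "x \<in> U" "0 \<in> V" "disjnt U V"
    using frechet
    by (force simp: frechet_space_def Hausdorff_space_def topspace_grading_topology)
  then obtain k \<epsilon> where "k \<ge> 1" "\<epsilon> > 0" "\<forall>y. snorm E k (y - x) < \<epsilon> \<longrightarrow> y \<in> U"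
    using openin_grading_topology_iff by blast
  then have "0 \<in> U" using assms[of k] snorm_minus[of k x] by force
  with U show False by (auto simp: disjnt_def)
qed

lemma Cauchy_converges:
  assumes "grading_Cauchy E X"
  obtains l where "\<And>k. 1 \<le> k \<Longrightarrow> (\<lambda>n. snorm E k (X n - l)) \<longlonglongrightarrow> 0"
proof -
  obtain l where l: "limitin (grading_topology E) X l sequentially"
    using frechet assms by (auto simp: frechet_space_def)
  have "(\<lambda>n. snorm E k (X n - l)) \<longlonglongrightarrow> 0" if k: "1 \<le> k" for k
  proof (rule order_tendstoI)
    fix a :: real assume "a < 0"
    then show "\<forall>\<^sub>F n in sequentially. a < snorm E k (X n - l)"
      using snorm_nonneg[OF k] by (auto intro: always_eventually less_le_trans)
  next
    fix a :: real assume "0 < a"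
    then show "\<forall>\<^sub>F n in sequentially. snorm E k (X n - l) < a"
      using l openin_ball[OF k, of a l] snorm_zero[OF k]
      by (auto simp: limitin_def)
  qed
  then show thesis using that by blast
qed

end

section \<open>Operator norms and continuity\<close>

locale frechet_pair = E: frechet E + F: frechet F
  for E :: "('k::real_normed_field, 'e::ab_group_add) graded_space"
    and F :: "('k, 'f::ab_group_add) graded_space"
begin

abbreviation "lin \<equiv> Vector_Spaces.linear (scal E) (scal F)"

lemma linI:
  assumes "\<And>x y. T (x + y) = T x + T y" "\<And>c x. T (scal E c x) = scal F c (T x)"
  shows "lin T"
  using assms by unfold_locales auto

lemma
  assumes "lin T"
  shows lin_add: "T (x + y) = T x + T y"
    and lin_scale: "T (scal E c x) = scal F c (T x)"
    and lin_diff: "T (x - y) = T x - T y"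
    and lin_zero: "T 0 = 0"
proof -
  interpret Vector_Spaces.linear "scal E" "scal F" T by fact
  show "T (x + y) = T x + T y" "T (scal E c x) = scal F c (T x)"
    "T (x - y) = T x - T y" "T 0 = 0"
    by (auto simp: add scale diff)
qed

text \<open>Homogeneity extends the bound from the unit ball to all vectors. Since
  \<open>snorm E r x\<close> may be 0, the vector is divided by an arbitrary \<open>a\<close> above
  it.\<close>

lemma op_norm_le_iff:
  assumes T: "lin T" and k: "1 \<le> k" and r: "1 \<le> r" and c: "0 \<le> c"
  shows "op_norm E F T k r \<le> ennreal c \<longleftrightarrow> (\<forall>x. snorm F k (T x) \<le> c * snorm E r x)"
proof
  assume le: "op_norm E F T k r \<le> ennreal c"
  have unit: "snorm F k (T x) \<le> c" if "snorm E r x \<le> 1" for x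
    using le that c by (auto simp: op_norm_def SUP_le_iff ennreal_le_iff)
  show "\<forall>x. snorm F k (T x) \<le> c * snorm E r x"
  proof
    fix x
    show "snorm F k (T x) \<le> c * snorm E r x"
    proof (rule le_mult_of_all_greater)
      fix a assume a: "snorm E r x < a"
      then have a0: "0 < a" using E.snorm_nonneg[OF r, of x] by simp
      have "snorm F k (T (scal E (of_real (1 / a)) x)) \<le> c"
        using a a0 by (intro unit) (simp add: E.snorm_scale[OF r] divide_simps norm_divide)
      then show "snorm F k (T x) \<le> c * a"
        using a0 by (simp add: lin_scale[OF T] F.snorm_scale[OF k] field_simps norm_divide)
    qed
  qed
next
  assume *: "\<forall>x. snorm F k (T x) \<le> c * snorm E r x"
  have "snorm F k (T x) \<le> c" if "snorm E r x \<le> 1" for x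
    using *[rule_format, of x] mult_left_mono[OF that c] by simp
  then show "op_norm E F T k r \<le> ennreal c"
    by (auto simp: op_norm_def intro!: SUP_least ennreal_leI)
qed

lemma op_norm_bound:
  assumes "lin T" "1 \<le> k" "1 \<le> r" "op_norm E F T k r < \<infinity>"
  shows "snorm F k (T x) \<le> enn2real (op_norm E F T k r) * snorm E r x"
  using op_norm_le_iff[OF assms(1-3), of "enn2real (op_norm E F T k r)"] assms(4) by simp

lemma op_norm_finiteI:
  assumes "lin T" "1 \<le> k" "1 \<le> r" "0 \<le> c" "\<And>x. snorm F k (T x) \<le> c * snorm E r x"
  shows "op_norm E F T k r < \<infinity>"
  using op_norm_le_iff[OF assms(1-4)] assms(5) by (auto intro: le_less_trans)

lemma op_norm_antimono:
  assumes "1 \<le> r" "r \<le> r'"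
  shows "op_norm E F T k r' \<le> op_norm E F T k r"
  unfolding op_norm_def
  using E.snorm_mono[OF assms] by (intro SUP_subset_mono) (auto intro: order_trans)

text \<open>Continuity at 0 yields a ball mapped into the unit ball of \<open>snorm F k\<close>, and
  scaling turns this into a finite norm. Conversely, finite norms give a Lipschitz estimate for each
  seminorm of \<open>F\<close>.\<close>

lemma cont_ops_iff:
  "T \<in> cont_ops E F \<longleftrightarrow> lin T \<and> (\<forall>k\<ge>1. \<exists>r\<ge>1. op_norm E F T k r < \<infinity>)"
proof safe
  assume "T \<in> cont_ops E F"
  then have lin: "lin T" and cont: "continuous_map (grading_topology E) (grading_topology F) T"
    by (auto simp: cont_ops_def)
  show "lin T" by fact
  fix k :: nat assume k: "1 \<le> k"
  have "openin (grading_topology E) {x. snorm F k (T x - 0) < 1}"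
    using openin_continuous_map_preimage[OF cont F.openin_ball[OF k, of 1 0]]
    by (simp add: E.topspace_grading_topology)
  moreover have "0 \<in> {x. snorm F k (T x - 0) < 1}"
    using F.snorm_zero[OF k] lin_zero[OF lin] by simp
  ultimately obtain r \<epsilon> where r: "1 \<le> r" "0 < \<epsilon>"
    and ball: "\<And>y. snorm E r (y - 0) < \<epsilon> \<Longrightarrow> y \<in> {x. snorm F k (T x - 0) < 1}"
    unfolding E.openin_grading_topology_iff by blast
  \<comment> \<open>The factor \<open>\<epsilon> / 2\<close> moves the closed unit ball strictly
    inside the open ball of radius \<open>\<epsilon>\<close>.\<close>
  have "op_norm E F T k r \<le> ennreal (2 / \<epsilon>)"
    unfolding op_norm_def
  proof (intro SUP_least ennreal_leI)
    fix x assume x: "x \<in> {x. snorm E r x \<le> 1}"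
    have "snorm F k (T (scal E (of_real (\<epsilon> / 2)) x)) < 1"
      using ball[of "scal E (of_real (\<epsilon> / 2)) x"] x r by (simp add: E.snorm_scale norm_divide)
    then show "snorm F k (T x) \<le> 2 / \<epsilon>"
      using r by (simp add: lin_scale[OF lin] F.snorm_scale[OF k] norm_divide field_simps)
  qed
  then have "op_norm E F T k r < \<infinity>" by (rule le_less_trans) simp
  then show "\<exists>r\<ge>1. op_norm E F T k r < \<infinity>" using r(1) by blast
next
  assume lin: "lin T" and fin: "\<forall>k\<ge>1. \<exists>r\<ge>1. op_norm E F T k r < \<infinity>"
  have "openin (grading_topology E) {x. T x \<in> U}" if U: "openin (grading_topology F) U" for U
    unfolding E.openin_grading_topology_iff
  proof
    fix x assume "x \<in> {x. T x \<in> U}"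
    then obtain k \<epsilon> where k: "1 \<le> k" "0 < \<epsilon>" "\<And>y. snorm F k (y - T x) < \<epsilon> \<Longrightarrow> y \<in> U"
      using U unfolding F.openin_grading_topology_iff by blast
    obtain r where r: "1 \<le> r" "op_norm E F T k r < \<infinity>" using fin k(1) by blast
    \<comment> \<open>Adding 1 makes \<open>c\<close> positive, so that
      \<open>\<epsilon> / c\<close> is a radius even when the norm is 0.\<close>
    define c where "c = enn2real (op_norm E F T k r) + 1"
    have c: "0 < c" by (simp add: c_def add_nonneg_pos)
    have "T y \<in> U" if "snorm E r (y - x) < \<epsilon> / c" for y
    proof (rule k(3))
      have "snorm F k (T y - T x) \<le> enn2real (op_norm E F T k r) * snorm E r (y - x)"
        using op_norm_bound[OF lin k(1) r, of "y - x"] by (simp add: lin_diff[OF lin])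
      also have "\<dots> \<le> c * snorm E r (y - x)"
        using E.snorm_nonneg[OF r(1)] by (intro mult_right_mono) (auto simp: c_def)
      also have "\<dots> < \<epsilon>" using that c by (simp add: field_simps)
      finally show "snorm F k (T y - T x) < \<epsilon>" .
    qed
    then show "\<exists>k\<ge>1. \<exists>\<epsilon>>0. \<forall>y. snorm E k (y - x) < \<epsilon> \<longrightarrow> y \<in> {x. T x \<in> U}"
      using r(1) k(2) c by (intro exI[of _ r] conjI exI[of _ "\<epsilon> / c"]) auto
  qed
  then show "T \<in> cont_ops E F"
    using lin by (simp add: cont_ops_def continuous_map_def E.topspace_grading_topology
        F.topspace_grading_topology)
qed

text \<open>Continuity makes the set of admissible indices nonempty, so its infimum is attained; the
  norm decreases in \<open>r\<close>, so every larger index is admissible too.\<close>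

lemma cont_char_le_iff:
  assumes "T \<in> cont_ops E F" "1 \<le> k" "1 \<le> r"
  shows "cont_char E F T k \<le> r \<longleftrightarrow> op_norm E F T k r < \<infinity>"
proof
  let ?A = "{r. 1 \<le> r \<and> op_norm E F T k r < \<infinity>}"
  have "?A \<noteq> {}" using assms by (auto simp: cont_ops_iff)
  then have "cont_char E F T k \<in> ?A"
    unfolding cont_char_def by (rule Inf_nat_def1)
  then show "op_norm E F T k r < \<infinity>" if "cont_char E F T k \<le> r"
    using op_norm_antimono[OF _ that] by (auto intro: le_less_trans)
  assume "op_norm E F T k r < \<infinity>"
  then show "cont_char E F T k \<le> r"
    unfolding cont_char_def using assms by (intro cInf_lower) auto
qed

end

section \<open>The operators bounded along \<phi> and their completeness\<close>

locale frechet_pair_bound = frechet_pair E F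
  for E :: "('k::real_normed_field, 'e::ab_group_add) graded_space"
    and F :: "('k, 'f::ab_group_add) graded_space" +
  fixes \<phi> :: "nat \<Rightarrow> nat"
  assumes phi: "\<phi> \<in> {1..} \<rightarrow> {1..}"
begin

abbreviation "L \<equiv> cont_ops_bounded \<phi> E F"

text \<open>A real-valued norm permits sums and differences. It is faithful only on
  \<open>L\<close>, since \<open>enn2real\<close> sends infinity to 0.\<close>

definition opn :: "nat \<Rightarrow> ('e \<Rightarrow> 'f) \<Rightarrow> real"
  where "opn k T = enn2real (op_norm E F T k (\<phi> k))"

lemma phi_ge: "1 \<le> k \<Longrightarrow> 1 \<le> \<phi> k"
  using phi by auto

lemma opn_nonneg: "0 \<le> opn k T"
  by (simp add: opn_def)

text \<open>The finite norms at \<open>(k, \<phi> k)\<close> already give continuity by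
  \<open>cont_ops_iff\<close>, because \<open>\<phi> k\<close> is an admissible index.\<close>

lemma L_iff: "T \<in> L \<longleftrightarrow> lin T \<and> (\<forall>k\<ge>1. op_norm E F T k (\<phi> k) < \<infinity>)"
  using phi_ge by (auto simp: cont_ops_bounded_def cont_ops_iff)

lemma L_lin: "T \<in> L \<Longrightarrow> lin T"
  by (simp add: L_iff)

lemma op_norm_eq_opn: "T \<in> L \<Longrightarrow> 1 \<le> k \<Longrightarrow> op_norm E F T k (\<phi> k) = ennreal (opn k T)"
  by (simp add: L_iff opn_def)

lemma opn_bound:
  assumes "T \<in> L" "1 \<le> k"
  shows "snorm F k (T x) \<le> opn k T * snorm E (\<phi> k) x"
  using assms op_norm_bound phi_ge by (simp add: L_iff opn_def)

lemma opn_le: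
  assumes "lin T" "1 \<le> k" "0 \<le> c" "\<And>x. snorm F k (T x) \<le> c * snorm E (\<phi> k) x"
  shows "opn k T \<le> c"
  unfolding opn_def using assms phi_ge by (intro enn2real_leI) (auto simp: op_norm_le_iff)

lemma L_I:
  assumes "lin T"
    and "\<And>k. 1 \<le> k \<Longrightarrow> \<exists>c\<ge>0. \<forall>x. snorm F k (T x) \<le> c * snorm E (\<phi> k) x"
  shows "T \<in> L"
  using assms phi_ge op_norm_finiteI unfolding L_iff by blast

lemma zero_L: "(\<lambda>_. 0) \<in> L"
  using F.snorm_zero by (auto intro!: L_I linI exI[of _ 0])

lemma diff_L:
  assumes "T \<in> L" "U \<in> L"
  shows "(\<lambda>x. T x - U x) \<in> L"
    and "1 \<le> k \<Longrightarrow> opn k (\<lambda>x. T x - U x) \<le> opn k T + opn k U"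
proof -
  note lin = assms[THEN L_lin]
  have "lin (\<lambda>x. T x - U x)"
    by (rule linI)
      (simp_all add: lin[THEN lin_add] lin[THEN lin_scale] F.scale_right_diff_distrib)
  moreover have "snorm F k (T x - U x) \<le> (opn k T + opn k U) * snorm E (\<phi> k) x" if "1 \<le> k" for k x
    using F.snorm_diff_le[OF that, of "T x" "U x"] opn_bound[OF assms(1) that, of x]
      opn_bound[OF assms(2) that, of x] by (simp add: algebra_simps)
  ultimately show "(\<lambda>x. T x - U x) \<in> L"
    and "1 \<le> k \<Longrightarrow> opn k (\<lambda>x. T x - U x) \<le> opn k T + opn k U"
    using opn_nonneg[of _ T] opn_nonneg[of _ U]
    by (auto intro!: L_I opn_le exI[of _ "opn _ T + opn _ U"])
qed

lemma scale_L:
  assumes "T \<in> L"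
  shows "(\<lambda>x. scal F a (T x)) \<in> L"
    and "1 \<le> k \<Longrightarrow> opn k (\<lambda>x. scal F a (T x)) \<le> norm a * opn k T"
proof -
  note lin = assms[THEN L_lin]
  have "lin (\<lambda>x. scal F a (T x))"
    by (rule linI)
      (simp_all add: lin_add[OF lin] lin_scale[OF lin] F.scale_right_distrib mult.commute)
  moreover have "snorm F k (scal F a (T x)) \<le> (norm a * opn k T) * snorm E (\<phi> k) x"
    if "1 \<le> k" for k x
    using mult_left_mono[OF opn_bound[OF assms that, of x], of "norm a"]
    by (simp add: F.snorm_scale[OF that] mult.assoc)
  ultimately show "(\<lambda>x. scal F a (T x)) \<in> L"
    and "1 \<le> k \<Longrightarrow> opn k (\<lambda>x. scal F a (T x)) \<le> norm a * opn k T"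
    using opn_nonneg[of _ T] by (auto intro!: L_I opn_le exI[of _ "norm a * opn _ T"])
qed

lemma uminus_L:
  assumes "T \<in> L"
  shows "(\<lambda>x. - T x) \<in> L" and "1 \<le> k \<Longrightarrow> opn k (\<lambda>x. - T x) \<le> opn k T"
  using scale_L[OF assms, where a = "- 1"] by simp_all

lemma add_L:
  assumes "T \<in> L" "U \<in> L"
  shows "(\<lambda>x. T x + U x) \<in> L"
  using diff_L(1)[OF assms(1) uminus_L(1)[OF assms(2)]] by simp

lemma opn_diff_commute:
  assumes "T \<in> L" "U \<in> L" "1 \<le> k"
  shows "opn k (\<lambda>x. T x - U x) = opn k (\<lambda>x. U x - T x)"
  using uminus_L(2)[OF diff_L(1)[OF assms(1,2)] assms(3)]
    uminus_L(2)[OF diff_L(1)[OF assms(2,1)] assms(3)] by simp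

text \<open>Write \<open>T - V\<close> as \<open>(T - U) - (V - U)\<close> and use the symmetry of
  the last difference.\<close>

lemma opn_diff_triangle:
  assumes "T \<in> L" "U \<in> L" "V \<in> L" "1 \<le> k"
  shows "opn k (\<lambda>x. T x - V x) \<le> opn k (\<lambda>x. T x - U x) + opn k (\<lambda>x. U x - V x)"
  using diff_L(2)[OF diff_L(1)[OF assms(1,2)] diff_L(1)[OF assms(3,2)] assms(4)]
    opn_diff_commute[OF assms(3,2,4)] by simp

lemma opn_zero: "1 \<le> k \<Longrightarrow> opn k (\<lambda>_. 0) = 0"
  using opn_le[OF L_lin[OF zero_L], of k 0] opn_nonneg[of k "\<lambda>_. 0"] F.snorm_zero[of k] by simp

text \<open>Completeness of \<open>F\<close> gives a pointwise limit \<open>U\<close>. It is linear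
  because the seminorms of \<open>F\<close> separate points, and letting \<open>j\<close> tend to
  infinity in the Cauchy estimate gives convergence uniformly on the unit ball of
  \<open>snorm E (\<phi> k)\<close>.\<close>

lemma L_complete:
  fixes T :: "nat \<Rightarrow> 'e \<Rightarrow> 'f"
  assumes T: "\<And>n. T n \<in> L"
    and Cauchy: "\<And>k \<epsilon>. 1 \<le> k \<Longrightarrow> 0 < \<epsilon> \<Longrightarrow>
      \<exists>N. \<forall>i\<ge>N. \<forall>j\<ge>N. opn k (\<lambda>x. T i x - T j x) < \<epsilon>"
  obtains U where "U \<in> L"
    "\<And>k \<epsilon>. 1 \<le> k \<Longrightarrow> 0 < \<epsilon> \<Longrightarrow> \<exists>N. \<forall>i\<ge>N. opn k (\<lambda>x. T i x - U x) < \<epsilon>"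
proof -
  note lin = T[THEN L_lin]
  have "grading_Cauchy F (\<lambda>n. T n x)" for x
    unfolding grading_Cauchy_def
  proof (intro allI impI)
    fix k :: nat and \<epsilon> :: real assume k: "1 \<le> k" and \<epsilon>: "0 < \<epsilon>"
    \<comment> \<open>Adding 1 allows division even when the seminorm of \<open>x\<close> is
      0.\<close>
    let ?c = "snorm E (\<phi> k) x + 1"
    have c: "0 < ?c" using E.snorm_nonneg[OF phi_ge[OF k], of x] by simp
    then obtain N where N: "\<And>i j. i \<ge> N \<Longrightarrow> j \<ge> N \<Longrightarrow> opn k (\<lambda>x. T i x - T j x) < \<epsilon> / ?c"
      using Cauchy[OF k, of "\<epsilon> / ?c"] \<epsilon> by (meson divide_pos_pos)
    have "snorm F k (T i x - T j x) < \<epsilon>" if "i \<ge> N" "j \<ge> N" for i j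
    proof -
      have "snorm F k (T i x - T j x) \<le> opn k (\<lambda>x. T i x - T j x) * snorm E (\<phi> k) x"
        using opn_bound[OF diff_L(1)[OF T T] k] .
      also have "\<dots> \<le> opn k (\<lambda>x. T i x - T j x) * ?c"
        using opn_nonneg by (intro mult_left_mono) auto
      also have "\<dots> < \<epsilon>" using N[OF that] c by (simp add: field_simps)
      finally show ?thesis .
    qed
    then show "\<exists>N. \<forall>m\<ge>N. \<forall>n\<ge>N. snorm F k (T m x - T n x) < \<epsilon>" by blast
  qed
  then have "\<exists>l. \<forall>k\<ge>1. (\<lambda>n. snorm F k (T n x - l)) \<longlonglongrightarrow> 0" for x
    by (metis F.Cauchy_converges)
  then obtain U where U: "\<And>x k. 1 \<le> k \<Longrightarrow> (\<lambda>n. snorm F k (T n x - U x)) \<longlonglongrightarrow> 0"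
    by metis
  have "lin U"
  proof (rule linI)
    fix x y
    have "snorm F k (U (x + y) - (U x + U y)) = 0" if k: "1 \<le> k" for k
    proof -
      have "snorm F k (U (x + y) - (U x + U y)) \<le> snorm F k (T n (x + y) - U (x + y))
          + snorm F k (T n x - U x) + snorm F k (T n y - U y)" for n
        using F.snorm_diff_le[OF k, of "(T n x - U x) + (T n y - U y)" "T n (x + y) - U (x + y)"]
          F.snorm_triangle[OF k, of "T n x - U x" "T n y - U y"]
        by (simp add: lin_add[OF lin] algebra_simps)
      moreover have "(\<lambda>n. snorm F k (T n (x + y) - U (x + y))
          + snorm F k (T n x - U x) + snorm F k (T n y - U y)) \<longlonglongrightarrow> 0 + 0 + 0"
        by (intro tendsto_add U k)
      ultimately have "snorm F k (U (x + y) - (U x + U y)) \<le> 0 + 0 + 0"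
        by (intro LIMSEQ_le_const) auto
      then show ?thesis using F.snorm_nonneg[OF k] by (simp add: antisym)
    qed
    then show "U (x + y) = U x + U y" using F.eq_zeroI by (metis eq_iff_diff_eq_0)
  next
    fix c x
    have "snorm F k (U (scal E c x) - scal F c (U x)) = 0" if k: "1 \<le> k" for k
    proof -
      have "snorm F k (U (scal E c x) - scal F c (U x)) \<le> norm c * snorm F k (T n x - U x)
          + snorm F k (T n (scal E c x) - U (scal E c x))" for n
        using F.snorm_diff_le[OF k, of "scal F c (T n x - U x)" "T n (scal E c x) - U (scal E c x)"]
        by (simp add: lin_scale[OF lin] F.snorm_scale[OF k, symmetric] F.scale_right_diff_distrib)
      moreover have "(\<lambda>n. norm c * snorm F k (T n x - U x)
          + snorm F k (T n (scal E c x) - U (scal E c x))) \<longlonglongrightarrow> norm c * 0 + 0"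
        by (intro tendsto_intros U k)
      ultimately have "snorm F k (U (scal E c x) - scal F c (U x)) \<le> norm c * 0 + 0"
        by (intro LIMSEQ_le_const) auto
      then show ?thesis using F.snorm_nonneg[OF k] by (simp add: antisym)
    qed
    then show "U (scal E c x) = scal F c (U x)" using F.eq_zeroI by (metis eq_iff_diff_eq_0)
  qed
  have bound: "\<exists>N. \<forall>i\<ge>N. \<forall>x. snorm F k (T i x - U x) \<le> \<epsilon> * snorm E (\<phi> k) x"
    if k: "1 \<le> k" and \<epsilon>: "0 < \<epsilon>" for k \<epsilon>
  proof -
    obtain N where N: "\<And>i j. i \<ge> N \<Longrightarrow> j \<ge> N \<Longrightarrow> opn k (\<lambda>x. T i x - T j x) < \<epsilon>"
      using Cauchy[OF k \<epsilon>] by blast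
    have "snorm F k (T i x - U x) \<le> \<epsilon> * snorm E (\<phi> k) x" if i: "i \<ge> N" for i x
    proof (rule LIMSEQ_le_const)
      show "(\<lambda>j. \<epsilon> * snorm E (\<phi> k) x + snorm F k (T j x - U x)) \<longlonglongrightarrow> \<epsilon> * snorm E (\<phi> k) x"
        using tendsto_add[OF tendsto_const U[OF k]] by simp
      have "snorm F k (T i x - U x) \<le> \<epsilon> * snorm E (\<phi> k) x + snorm F k (T j x - U x)"
        if j: "j \<ge> N" for j
      proof -
        have "snorm F k (T i x - T j x) \<le> opn k (\<lambda>x. T i x - T j x) * snorm E (\<phi> k) x"
          using opn_bound[OF diff_L(1)[OF T T] k] .
        also have "\<dots> \<le> \<epsilon> * snorm E (\<phi> k) x"
          using N[OF i j] E.snorm_nonneg[OF phi_ge[OF k]] by (intro mult_right_mono) auto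
        finally show ?thesis using F.snorm_diff_triangle[OF k, of "T i x" "U x" "T j x"] by simp
      qed
      then show "\<exists>N. \<forall>j\<ge>N. snorm F k (T i x - U x) \<le> \<epsilon> * snorm E (\<phi> k) x + snorm F k (T j x - U x)"
        by blast
    qed
    then show ?thesis by blast
  qed
  have UL: "U \<in> L"
  proof (rule L_I[OF \<open>lin U\<close>])
    fix k :: nat assume k: "1 \<le> k"
    \<comment> \<open>One operator \<open>T N\<close> at distance at most 1 from \<open>U\<close>
      suffices to bound \<open>U\<close> at level \<open>k\<close>.\<close>
    obtain N where N: "\<And>x. snorm F k (T N x - U x) \<le> 1 * snorm E (\<phi> k) x"
      using bound[OF k, of 1] by auto
    have "snorm F k (U x) \<le> (opn k (T N) + 1) * snorm E (\<phi> k) x" for x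
      using F.snorm_diff_le[OF k, of "T N x" "T N x - U x"] N[of x] opn_bound[OF T[of N] k, of x]
      by (simp add: algebra_simps)
    then show "\<exists>c\<ge>0. \<forall>x. snorm F k (U x) \<le> c * snorm E (\<phi> k) x"
      using opn_nonneg[of k "T N"] by (intro exI[of _ "opn k (T N) + 1"]) auto
  qed
  moreover have "\<exists>N. \<forall>i\<ge>N. opn k (\<lambda>x. T i x - U x) < \<epsilon>" if k: "1 \<le> k" and \<epsilon>: "0 < \<epsilon>" for k \<epsilon>
  proof -
    \<comment> \<open>Pointwise bounds give only a weak inequality for \<open>opn\<close>; halving
      \<open>\<epsilon>\<close> makes it strict.\<close>
    obtain N where N: "\<And>i x. i \<ge> N \<Longrightarrow> snorm F k (T i x - U x) \<le> (\<epsilon> / 2) * snorm E (\<phi> k) x"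
      using bound[OF k, of "\<epsilon> / 2"] \<epsilon> by auto
    have "opn k (\<lambda>x. T i x - U x) < \<epsilon>" if "i \<ge> N" for i
      using opn_le[OF L_lin[OF diff_L(1)[OF T UL]] k, of "\<epsilon> / 2" i] N[OF that] \<epsilon> by simp
    then show ?thesis by blast
  qed
  ultimately show thesis using that by blast
qed

end

section \<open>Baire category on pairs of factors\<close>

text \<open>The expression tends to 0 with \<open>\<epsilon>\<close>. It is the error in
  \<open>R (Q x)\<close> when both factors move by at most \<open>\<epsilon>\<close>, as estimated
  in \<open>exceeding_open\<close>.\<close>

lemma bilinear_perturbation_small:
  fixes A B c \<delta> :: real
  assumes "0 \<le> A" "0 \<le> B" "0 \<le> c" "0 < \<delta>"
  obtains \<epsilon> where "0 < \<epsilon>" "\<epsilon> * (\<epsilon> * A + B) + c * (\<epsilon> * A) < \<delta>"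
proof -
  have "((\<lambda>\<epsilon>. \<epsilon> * (\<epsilon> * A + B) + c * (\<epsilon> * A)) \<longlongrightarrow> 0 * (0 * A + B) + c * (0 * A)) (at_right 0)"
    by (intro tendsto_intros)
  then have "\<forall>\<^sub>F \<epsilon> in at_right 0. \<epsilon> * (\<epsilon> * A + B) + c * (\<epsilon> * A) < \<delta>"
    using \<open>0 < \<delta>\<close> by (auto dest: order_tendstoD)
  moreover have "\<forall>\<^sub>F \<epsilon> in at_right 0. (0::real) < \<epsilon>"
    by (simp add: eventually_at_filter)
  ultimately have "\<forall>\<^sub>F \<epsilon> in at_right 0. 0 < \<epsilon> \<and> \<epsilon> * (\<epsilon> * A + B) + c * (\<epsilon> * A) < \<delta>"
    by eventually_elim simp
  then show thesis
    using that eventually_happens[of _ "at_right (0::real)"] by (auto simp: trivial_limit_at_right_real)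
qed

locale frechet_triple =
  EG: frechet_pair_bound E G \<phi> + GF: frechet_pair_bound G F \<phi> + EF: frechet_pair E F
  for E :: "('k::real_normed_field, 'e::ab_group_add) graded_space"
    and G :: "('k, 'g::ab_group_add) graded_space"
    and F :: "('k, 'f::ab_group_add) graded_space"
    and \<phi> :: "nat \<Rightarrow> nat"
begin

lemma lin_comp: "EG.lin Q \<Longrightarrow> GF.lin R \<Longrightarrow> EF.lin (R \<circ> Q)"
  by (rule EF.linI) (simp_all add: EG.lin_add EG.lin_scale GF.lin_add GF.lin_scale)

definition factors :: "(('e \<Rightarrow> 'g) \<times> ('g \<Rightarrow> 'f)) set"
  where "factors = EG.L \<times> GF.L"

text \<open>Summing over all levels up to \<open>m\<close> makes the pseudometrics increase with
  \<open>m\<close>; the single norms need not, since \<phi> is arbitrary.\<close>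

definition pdist :: "nat \<Rightarrow> ('e \<Rightarrow> 'g) \<times> ('g \<Rightarrow> 'f) \<Rightarrow> ('e \<Rightarrow> 'g) \<times> ('g \<Rightarrow> 'f) \<Rightarrow> real"
  where "pdist m z z' = (\<Sum>i=1..m. EG.opn i (\<lambda>x. fst z x - fst z' x))
    + (\<Sum>i=1..m. GF.opn i (\<lambda>x. snd z x - snd z' x))"

lemma opn_le_pdist:
  assumes "1 \<le> i" "i \<le> m"
  shows "EG.opn i (\<lambda>x. fst z x - fst z' x) \<le> pdist m z z'"
    and "GF.opn i (\<lambda>x. snd z x - snd z' x) \<le> pdist m z z'"
proof -
  have "EG.opn i (\<lambda>x. fst z x - fst z' x) \<le> (\<Sum>i=1..m. EG.opn i (\<lambda>x. fst z x - fst z' x))"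
    "GF.opn i (\<lambda>x. snd z x - snd z' x) \<le> (\<Sum>i=1..m. GF.opn i (\<lambda>x. snd z x - snd z' x))"
    using assms by (intro member_le_sum; simp add: EG.opn_nonneg GF.opn_nonneg)+
  moreover have "0 \<le> (\<Sum>i=1..m. EG.opn i (\<lambda>x. fst z x - fst z' x))"
    "0 \<le> (\<Sum>i=1..m. GF.opn i (\<lambda>x. snd z x - snd z' x))"
    by (intro sum_nonneg EG.opn_nonneg GF.opn_nonneg)+
  ultimately show "EG.opn i (\<lambda>x. fst z x - fst z' x) \<le> pdist m z z'"
    "GF.opn i (\<lambda>x. snd z x - snd z' x) \<le> pdist m z z'"
    unfolding pdist_def by linarith+
qed

text \<open>Both operator spaces are complete, so the componentwise limits of a Cauchy sequence of
  pairs form its limit in \<open>pdist\<close>.\<close>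

lemma factors_baire:
  assumes sub: "\<And>n. U n \<subseteq> factors"
    and opens: "\<And>n z. z \<in> U n \<Longrightarrow> \<exists>m. \<exists>\<epsilon>>0. \<forall>z'\<in>factors. pdist m z z' < \<epsilon> \<longrightarrow> z' \<in> U n"
    and dense: "\<And>n z m \<epsilon>. z \<in> factors \<Longrightarrow> 0 < \<epsilon> \<Longrightarrow> \<exists>z'\<in>U n. pdist m z z' < \<epsilon>"
  shows "\<exists>z\<in>factors. \<forall>n. z \<in> U (n::nat)"
proof (rule baire_pseudometrics[where p = pdist])
  show "factors \<noteq> {}" using EG.zero_L GF.zero_L by (auto simp: factors_def)
next
  fix m z show "pdist m z z = 0"
    by (auto simp: pdist_def EG.opn_zero GF.opn_zero)
next
  fix m z z' assume "z \<in> factors" "z' \<in> factors"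
  then show "pdist m z z' = pdist m z' z"
    unfolding pdist_def
    by (intro arg_cong2[where f = "(+)"] sum.cong EG.opn_diff_commute GF.opn_diff_commute)
      (auto simp: factors_def)
next
  fix m z z' z'' assume z: "z \<in> factors" "z' \<in> factors" "z'' \<in> factors"
  have "(\<Sum>i=1..m. EG.opn i (\<lambda>x. fst z x - fst z'' x)) \<le>
      (\<Sum>i=1..m. EG.opn i (\<lambda>x. fst z x - fst z' x) + EG.opn i (\<lambda>x. fst z' x - fst z'' x))"
    using z by (intro sum_mono EG.opn_diff_triangle) (auto simp: factors_def)
  moreover have "(\<Sum>i=1..m. GF.opn i (\<lambda>x. snd z x - snd z'' x)) \<le>
      (\<Sum>i=1..m. GF.opn i (\<lambda>x. snd z x - snd z' x) + GF.opn i (\<lambda>x. snd z' x - snd z'' x))"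
    using z by (intro sum_mono GF.opn_diff_triangle) (auto simp: factors_def)
  ultimately show "pdist m z z'' \<le> pdist m z z' + pdist m z' z''"
    by (simp add: pdist_def sum.distrib)
next
  fix l m :: nat and z z' assume "l \<le> m"
  then show "pdist l z z' \<le> pdist m z z'"
    unfolding pdist_def
    by (intro add_mono sum_mono2) (auto simp: EG.opn_nonneg GF.opn_nonneg)
next
  fix u :: "nat \<Rightarrow> _" assume u: "range u \<subseteq> factors"
    and Cauchy: "\<And>m \<epsilon>. 0 < \<epsilon> \<Longrightarrow> \<exists>N. \<forall>i\<ge>N. \<forall>j\<ge>N. pdist m (u i) (u j) < \<epsilon>"
  have uL: "fst (u n) \<in> EG.L" "snd (u n) \<in> GF.L" for n
    using u by (auto simp: factors_def image_subset_iff mem_Times_iff)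
  obtain Q where Q: "Q \<in> EG.L"
    "\<And>k \<epsilon>. 1 \<le> k \<Longrightarrow> 0 < \<epsilon> \<Longrightarrow> \<exists>N. \<forall>i\<ge>N. EG.opn k (\<lambda>x. fst (u i) x - Q x) < \<epsilon>"
  proof (rule EG.L_complete[of "\<lambda>n. fst (u n)"])
    show "\<exists>N. \<forall>i\<ge>N. \<forall>j\<ge>N. EG.opn k (\<lambda>x. fst (u i) x - fst (u j) x) < \<epsilon>"
      if "1 \<le> k" "0 < \<epsilon>" for k \<epsilon>
      using Cauchy[OF that(2), of k] opn_le_pdist(1)[OF that(1) order_refl]
      by (meson le_less_trans)
  qed (use uL in auto)
  obtain R where R: "R \<in> GF.L"
    "\<And>k \<epsilon>. 1 \<le> k \<Longrightarrow> 0 < \<epsilon> \<Longrightarrow> \<exists>N. \<forall>i\<ge>N. GF.opn k (\<lambda>x. snd (u i) x - R x) < \<epsilon>"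
  proof (rule GF.L_complete[of "\<lambda>n. snd (u n)"])
    show "\<exists>N. \<forall>i\<ge>N. \<forall>j\<ge>N. GF.opn k (\<lambda>x. snd (u i) x - snd (u j) x) < \<epsilon>"
      if "1 \<le> k" "0 < \<epsilon>" for k \<epsilon>
      using Cauchy[OF that(2), of k] opn_le_pdist(2)[OF that(1) order_refl]
      by (meson le_less_trans)
  qed (use uL in auto)
  have lim: "(\<lambda>n. pdist m (u n) (Q, R)) \<longlonglongrightarrow> 0" for m
  proof -
    have "(\<lambda>n. EG.opn i (\<lambda>x. fst (u n) x - Q x)) \<longlonglongrightarrow> 0"
      "(\<lambda>n. GF.opn i (\<lambda>x. snd (u n) x - R x)) \<longlonglongrightarrow> 0" if "i \<in> {1..m}" for i
      using Q(2)[of i] R(2)[of i] that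
      by (auto simp: LIMSEQ_iff EG.opn_nonneg GF.opn_nonneg)
    then have "(\<lambda>n. pdist m (u n) (Q, R)) \<longlonglongrightarrow> (\<Sum>i=1..m. 0) + (\<Sum>i=1..m. 0)"
      unfolding pdist_def fst_conv snd_conv by (intro tendsto_add tendsto_sum) auto
    then show ?thesis by simp
  qed
  have "\<exists>N. \<forall>i\<ge>N. pdist m (u i) (Q, R) < \<epsilon>" if "0 < \<epsilon>" for m \<epsilon>
    using order_tendstoD(2)[OF lim that] by (simp add: eventually_sequentially)
  with Q(1) R(1) show "\<exists>l\<in>factors. \<forall>m. \<forall>\<epsilon>>0. \<exists>N. \<forall>i\<ge>N. pdist m (u i) l < \<epsilon>"
    by (intro bexI[of _ "(Q, R)"]) (auto simp: factors_def)
qed (fact assms)+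

text \<open>For \<open>c \<ge> 0\<close> these are the pairs whose product has norm above
  \<open>c\<close> at \<open>(k, r)\<close>. The strict inequality at a single witness
  \<open>x\<close> is what makes the set open.\<close>

definition exceeding :: "nat \<Rightarrow> nat \<Rightarrow> real \<Rightarrow> (('e \<Rightarrow> 'g) \<times> ('g \<Rightarrow> 'f)) set"
  where "exceeding k r c =
    {z \<in> factors. \<exists>x. snorm E r x \<le> 1 \<and> c < snorm F k (snd z (fst z x))}"

text \<open>The witness \<open>x\<close> is kept. The change of \<open>R (Q x)\<close> splits into
  \<open>R (Q x - Q' x)\<close> and \<open>(R - R') (Q' x)\<close>, both small near
  \<open>(Q, R)\<close>.\<close>

lemma exceeding_open:
  assumes k: "1 \<le> k" and z: "z \<in> exceeding k r c"
  shows "\<exists>m. \<exists>\<epsilon>>0. \<forall>z'\<in>factors. pdist m z z' < \<epsilon> \<longrightarrow> z' \<in> exceeding k r c"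
proof -
  obtain Q R where QR: "z = (Q, R)" "Q \<in> EG.L" "R \<in> GF.L"
    using z by (auto simp: exceeding_def factors_def)
  obtain x where x: "snorm E r x \<le> 1" "c < snorm F k (R (Q x))"
    using z QR(1) by (auto simp: exceeding_def)
  \<comment> \<open>The norm of \<open>R\<close> at level \<open>k\<close> is taken against level
    \<open>\<phi> k\<close> of \<open>G\<close>, so \<open>Q\<close> has to be controlled at that
    level; \<open>m\<close> covers both.\<close>
  define l where "l = \<phi> k"
  define m where "m = max k l"
  define A where "A = snorm E (\<phi> l) x"
  define B where "B = snorm G l (Q x)"
  have l: "1 \<le> l" using EG.phi_ge[OF k] by (simp add: l_def)
  have AB: "0 \<le> A" "0 \<le> B"
    using EG.E.snorm_nonneg[OF EG.phi_ge[OF l]] EG.F.snorm_nonneg[OF l] by (auto simp: A_def B_def)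
  obtain \<epsilon> where \<epsilon>: "0 < \<epsilon>" "\<epsilon> * (\<epsilon> * A + B) + GF.opn k R * (\<epsilon> * A) < snorm F k (R (Q x)) - c"
    using bilinear_perturbation_small[OF AB GF.opn_nonneg[of k R]] x(2) by (metis diff_gt_0_iff_gt)
  have "z' \<in> exceeding k r c" if z': "z' \<in> factors" and d: "pdist m z z' < \<epsilon>" for z'
  proof -
    obtain Q' R' where QR': "z' = (Q', R')" "Q' \<in> EG.L" "R' \<in> GF.L"
      using z' by (auto simp: factors_def)
    have dQ: "EG.opn l (\<lambda>x. Q x - Q' x) \<le> \<epsilon>" and dR: "GF.opn k (\<lambda>x. R x - R' x) \<le> \<epsilon>"
      using opn_le_pdist(1)[of l m z z'] opn_le_pdist(2)[of k m z z'] k l d QR(1) QR'(1)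
      by (auto simp: m_def)
    let ?d = "Q x - Q' x"
    have "snorm G l ?d \<le> EG.opn l (\<lambda>x. Q x - Q' x) * A"
      unfolding A_def by (rule EG.opn_bound[OF EG.diff_L(1)[OF QR(2) QR'(2)] l])
    also have "\<dots> \<le> \<epsilon> * A" using dQ AB by (intro mult_right_mono)
    finally have d1: "snorm G l ?d \<le> \<epsilon> * A" .
    have "snorm G l (Q' x) \<le> \<epsilon> * A + B"
      using EG.F.snorm_diff_le[OF l, of "Q x" ?d] d1 by (simp add: B_def)
    moreover have "snorm F k (R (Q' x) - R' (Q' x)) \<le> GF.opn k (\<lambda>x. R x - R' x) * snorm G l (Q' x)"
      unfolding l_def by (rule GF.opn_bound[OF GF.diff_L(1)[OF QR(3) QR'(3)] k])
    ultimately have d2: "snorm F k (R (Q' x) - R' (Q' x)) \<le> \<epsilon> * (\<epsilon> * A + B)"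
      using dR \<epsilon>(1) AB GF.opn_nonneg EG.F.snorm_nonneg[OF l, of "Q' x"]
      by (meson mult_mono order_trans less_imp_le)
    have "snorm F k (R ?d) \<le> GF.opn k R * snorm G l ?d"
      unfolding l_def by (rule GF.opn_bound[OF QR(3) k])
    also have "\<dots> \<le> GF.opn k R * (\<epsilon> * A)"
      using d1 GF.opn_nonneg by (intro mult_left_mono)
    finally have d3: "snorm F k (R (Q x) - R (Q' x)) \<le> GF.opn k R * (\<epsilon> * A)"
      by (simp add: GF.lin_diff[OF GF.L_lin[OF QR(3)]])
    have "snorm F k (R (Q x)) - snorm F k (R' (Q' x)) \<le> snorm F k (R (Q x) - R' (Q' x))"
      using GF.F.snorm_triangle[OF k, of "R (Q x) - R' (Q' x)" "R' (Q' x)"] by simp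
    also have "\<dots> \<le> \<epsilon> * (\<epsilon> * A + B) + GF.opn k R * (\<epsilon> * A)"
      using GF.F.snorm_diff_triangle[OF k, of "R (Q x)" "R' (Q' x)" "R (Q' x)"] d2 d3 by simp
    finally have "c < snorm F k (R' (Q' x))" using \<epsilon>(2) by simp
    then show ?thesis using z' x(1) QR'(1) by (auto simp: exceeding_def)
  qed
  then show ?thesis using \<epsilon>(1) by blast
qed

text \<open>
  On a ball around \<open>(Q0, R0)\<close> that avoids \<open>exceeding k r c\<close>, the product \<open>RQ\<close> is recovered by
  polarisation from the four bounded products \<open>(R0 + t R) (Q0 + s Q)\<close>, \<open>(R0 + t R) Q0\<close>,
  \<open>R0 (Q0 + s Q)\<close> and \<open>R0 Q0\<close>.
\<close>

lemma bilinear_bound: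
  assumes k: "1 \<le> k" and \<epsilon>: "0 < \<epsilon>" and c: "0 \<le> c" and z: "(Q0, R0) \<in> factors"
    and ball: "\<And>z. z \<in> factors \<Longrightarrow> pdist m (Q0, R0) z < \<epsilon> \<Longrightarrow> z \<notin> exceeding k r c"
    and m: "1 \<le> m"
    and Q: "Q \<in> EG.L" "\<And>i. i \<in> {1..m} \<Longrightarrow> EG.opn i Q \<le> a"
    and R: "R \<in> GF.L" "\<And>i. i \<in> {1..m} \<Longrightarrow> GF.opn i R \<le> b"
    and x: "snorm E r x \<le> 1"
  shows "snorm F k (R (Q x)) \<le> 4 * c * (4 * real m / \<epsilon>)\<^sup>2 * b * a"
proof (rule le_mult_of_all_greater)
  fix a' assume a': "a < a'"
  have "snorm F k (R (Q x)) \<le> (4 * c * (4 * real m / \<epsilon>)\<^sup>2 * a') * b"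
  proof (rule le_mult_of_all_greater)
    fix b' assume b': "b < b'"
    \<comment> \<open>Index 1 is in range as \<open>1 \<le> m\<close>, so \<open>a\<close> and
      \<open>b\<close> are nonnegative and the larger \<open>a'\<close> and \<open>b'\<close> may be
      divided by.\<close>
    have pos: "0 < a'" "0 < b'"
      using Q(2)[of 1] R(2)[of 1] m a' b' EG.opn_nonneg[of 1 Q] GF.opn_nonneg[of 1 R] by auto
    \<comment> \<open>Each of the \<open>m\<close> summands of a perturbation is then at most
      \<open>\<epsilon> / (4 * real m)\<close>, so each of the two sums in \<open>pdist\<close> is
      at most \<open>\<epsilon> / 4\<close> and the perturbed pairs stay in the ball.\<close>
    define s t where "s = \<epsilon> / (4 * real m * a')" and "t = \<epsilon> / (4 * real m * b')"
    have st: "0 < s" "0 < t" using pos \<epsilon> m by (auto simp: s_def t_def)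
    have QR0: "Q0 \<in> EG.L" "R0 \<in> GF.L" using z by (auto simp: factors_def)
    define Qs where "Qs = (\<lambda>x. scal G (of_real s) (Q x))"
    define Rt where "Rt = (\<lambda>x. scal F (of_real t) (R x))"
    have L: "Qs \<in> EG.L" "Rt \<in> GF.L"
      unfolding Qs_def Rt_def by (rule EG.scale_L(1)[OF Q(1)] GF.scale_L(1)[OF R(1)])+
    define Q1 where "Q1 = (\<lambda>x. Q0 x + Qs x)"
    define R1 where "R1 = (\<lambda>x. R0 x + Rt x)"
    have L1: "Q1 \<in> EG.L" "R1 \<in> GF.L"
      unfolding Q1_def R1_def by (rule EG.add_L[OF QR0(1) L(1)] GF.add_L[OF QR0(2) L(2)])+
    have "EG.opn i (\<lambda>x. Q0 x - Q1 x) \<le> s * a'" if i: "i \<in> {1..m}" for i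
    proof -
      have "EG.opn i (\<lambda>x. Q0 x - Q1 x) \<le> EG.opn i Qs"
        using EG.uminus_L(2)[OF L(1), of i] i by (simp add: Q1_def)
      also have "\<dots> \<le> s * EG.opn i Q"
        unfolding Qs_def using EG.scale_L(2)[OF Q(1), of i "of_real s"] i st by simp
      also have "\<dots> \<le> s * a'" using Q(2)[OF i] a' st by (intro mult_left_mono) auto
      finally show ?thesis .
    qed
    then have sQ: "(\<Sum>i=1..m. EG.opn i (\<lambda>x. Q0 x - Q1 x)) \<le> \<epsilon> / 4"
      using sum_bounded_above[of "{1..m}" "\<lambda>i. EG.opn i (\<lambda>x. Q0 x - Q1 x)" "s * a'"] pos m
      by (simp add: s_def)
    have "GF.opn i (\<lambda>x. R0 x - R1 x) \<le> t * b'" if i: "i \<in> {1..m}" for i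
    proof -
      have "GF.opn i (\<lambda>x. R0 x - R1 x) \<le> GF.opn i Rt"
        using GF.uminus_L(2)[OF L(2), of i] i by (simp add: R1_def)
      also have "\<dots> \<le> t * GF.opn i R"
        unfolding Rt_def using GF.scale_L(2)[OF R(1), of i "of_real t"] i st by simp
      also have "\<dots> \<le> t * b'" using R(2)[OF i] b' st by (intro mult_left_mono) auto
      finally show ?thesis .
    qed
    then have sR: "(\<Sum>i=1..m. GF.opn i (\<lambda>x. R0 x - R1 x)) \<le> \<epsilon> / 4"
      using sum_bounded_above[of "{1..m}" "\<lambda>i. GF.opn i (\<lambda>x. R0 x - R1 x)" "t * b'"] pos m
      by (simp add: t_def)
    have small: "snorm F k (R' (Q' x)) \<le> c" if "Q' \<in> {Q0, Q1}" "R' \<in> {R0, R1}" for Q' R'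
    proof -
      have f: "(Q', R') \<in> factors" using that QR0 L1 by (auto simp: factors_def)
      have zero: "(\<Sum>i=1..m. EG.opn i (\<lambda>_. 0)) = 0"
        "(\<Sum>i=1..m. GF.opn i (\<lambda>_. 0)) = 0"
        using EG.opn_zero GF.opn_zero by (auto intro!: sum.neutral)
      have "pdist m (Q0, R0) (Q', R') < \<epsilon>"
        using that sQ sR \<epsilon> zero by (auto simp: pdist_def)
      then have "(Q', R') \<notin> exceeding k r c" using ball[OF f] by simp
      then show ?thesis using f x by (auto simp: exceeding_def not_less)
    qed
    have d: "snorm F k (R' (Q1 x) - R' (Q0 x)) \<le> c + c" if "R' \<in> {R0, R1}" for R'
      using GF.F.snorm_diff_le[OF k, of "R' (Q1 x)" "R' (Q0 x)"] small[of Q1 R'] small[of Q0 R'] that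
      by simp
    have "snorm F k ((R1 (Q1 x) - R1 (Q0 x)) - (R0 (Q1 x) - R0 (Q0 x))) \<le> (c + c) + (c + c)"
      using GF.F.snorm_diff_le[OF k, of "R1 (Q1 x) - R1 (Q0 x)" "R0 (Q1 x) - R0 (Q0 x)"]
        d[of R0] d[of R1] by simp
    \<comment> \<open>The mixed second difference leaves only the term containing both
      perturbations.\<close>
    moreover have "Rt (Qs x) = (R1 (Q1 x) - R1 (Q0 x)) - (R0 (Q1 x) - R0 (Q0 x))"
      using GF.lin_add[OF GF.L_lin[OF L(2)]] GF.lin_add[OF GF.L_lin[OF QR0(2)]]
      by (simp add: R1_def Q1_def)
    moreover have "snorm F k (Rt (Qs x)) = t * (s * snorm F k (R (Q x)))"
      using st by (simp add: Rt_def Qs_def GF.lin_scale[OF GF.L_lin[OF R(1)]] GF.F.snorm_scale[OF k] norm_mult)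
    ultimately have "t * (s * snorm F k (R (Q x))) \<le> 4 * c" by simp
    \<comment> \<open>Dividing by \<open>s * t\<close> produces the squared factor together with
      \<open>a'\<close> and \<open>b'\<close>.\<close>
    then show "snorm F k (R (Q x)) \<le> 4 * c * (4 * real m / \<epsilon>)\<^sup>2 * a' * b'"
      using pos \<epsilon> m by (simp add: s_def t_def field_simps power2_eq_square)
  qed
  then show "snorm F k (R (Q x)) \<le> 4 * c * (4 * real m / \<epsilon>)\<^sup>2 * b * a'"
    by (simp add: mult_ac)
qed

definition bounded_product :: "nat \<Rightarrow> nat \<Rightarrow> bool"
  where "bounded_product k r \<longleftrightarrow> (\<exists>qk\<ge>1. \<exists>C>0::real. \<forall>Q\<in>EG.L. \<forall>R\<in>GF.L.
    op_norm E F (R \<circ> Q) k r \<le> ennreal C * (MAX q\<in>{1..qk}. op_norm G F R q (\<phi> q))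
      * (MAX q\<in>{1..qk}. op_norm E G Q q (\<phi> q)))"

text \<open>This is density in contrapositive form: a ball missing \<open>exceeding k r c\<close>
  yields, by \<open>bilinear_bound\<close>, an estimate valid for all pairs.\<close>

lemma bounded_productI:
  assumes k: "1 \<le> k" and \<epsilon>: "0 < \<epsilon>" and c: "0 \<le> c" and z: "z0 \<in> factors"
    and ball: "\<And>z. z \<in> factors \<Longrightarrow> pdist m z0 z < \<epsilon> \<Longrightarrow> z \<notin> exceeding k r c"
  shows "bounded_product k r"
proof -
  obtain Q0 R0 where z0: "z0 = (Q0, R0)" by (cases z0)
  \<comment> \<open>\<open>Suc m\<close> keeps the index range of the maxima nonempty when
    \<open>m\<close> is 0, and \<open>c + 1\<close> keeps \<open>C\<close> positive when
    \<open>c\<close> is 0.\<close>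
  define q where "q = Suc m"
  define C where "C = 4 * (c + 1) * (4 * real q / \<epsilon>)\<^sup>2"
  have q: "1 \<le> q" and C: "0 < C" using \<epsilon> c by (auto simp: q_def C_def intro!: mult_pos_pos)
  have ball': "z \<notin> exceeding k r (c + 1)" if "z \<in> factors" "pdist q (Q0, R0) z < \<epsilon>" for z
  proof -
    have "pdist m (Q0, R0) z \<le> pdist q (Q0, R0) z"
      unfolding pdist_def
      by (intro add_mono sum_mono2) (auto simp: EG.opn_nonneg GF.opn_nonneg q_def)
    then have "z \<notin> exceeding k r c" using ball that z0 by simp
    moreover have "exceeding k r (c + 1) \<subseteq> exceeding k r c" by (force simp: exceeding_def)
    ultimately show ?thesis by blast
  qed
  have fin: "finite {1..q}" "{1..q} \<noteq> {}" using q by auto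
  show ?thesis
    unfolding bounded_product_def
  proof (intro exI conjI ballI)
    fix Q R assume Q: "Q \<in> EG.L" and R: "R \<in> GF.L"
    define a where "a = (MAX i\<in>{1..q}. EG.opn i Q)"
    define b where "b = (MAX i\<in>{1..q}. GF.opn i R)"
    have a: "EG.opn i Q \<le> a" and b: "GF.opn i R \<le> b" if "i \<in> {1..q}" for i
      using that by (auto simp: a_def b_def)
    \<comment> \<open>The real maxima are attained at some index, where they can be compared with
      the extended maxima.\<close>
    have "a \<in> (\<lambda>i. EG.opn i Q) ` {1..q}" "b \<in> (\<lambda>i. GF.opn i R) ` {1..q}"
      unfolding a_def b_def using fin by (intro Max_in; simp)+
    then have a': "ennreal a \<le> (MAX i\<in>{1..q}. op_norm E G Q i (\<phi> i))"
      and b': "ennreal b \<le> (MAX i\<in>{1..q}. op_norm G F R i (\<phi> i))"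
      using EG.op_norm_eq_opn[OF Q] GF.op_norm_eq_opn[OF R] by (auto intro!: Max_ge image_eqI)
    have ab: "0 \<le> a" "0 \<le> b"
      using a[of 1] b[of 1] q EG.opn_nonneg[of 1 Q] GF.opn_nonneg[of 1 R] by auto
    have "op_norm E F (R \<circ> Q) k r \<le> ennreal (C * b * a)"
      unfolding op_norm_def
    proof (intro SUP_least ennreal_leI)
      fix x assume "x \<in> {x. snorm E r x \<le> 1}"
      then show "snorm F k ((R \<circ> Q) x) \<le> C * b * a"
        using bilinear_bound[OF k \<epsilon> _ z[unfolded z0] ball' q Q a R b, of x] c
        by (simp add: C_def)
    qed
    also have "\<dots> = ennreal C * ennreal b * ennreal a"
      using C ab by (simp add: ennreal_mult)
    also have "\<dots> \<le> ennreal C * (MAX i\<in>{1..q}. op_norm G F R i (\<phi> i))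
        * (MAX i\<in>{1..q}. op_norm E G Q i (\<phi> i))"
      using a' b' by (intro mult_mono) auto
    finally show "op_norm E F (R \<circ> Q) k r \<le> ennreal C * (MAX i\<in>{1..q}. op_norm G F R i (\<phi> i))
        * (MAX i\<in>{1..q}. op_norm E G Q i (\<phi> i))" .
  qed (use q C in auto)
qed

text \<open>Baire's theorem is applied to the sets \<open>exceeding k (S k) n\<close> for all
  \<open>k \<in> B\<close> and all \<open>n\<close> at once; a common point has infinite norm at
  every such \<open>k\<close>.\<close>

lemma unbounded_product:
  assumes "\<And>k. k \<in> B \<Longrightarrow> 1 \<le> k \<and> \<not> bounded_product k (S k)"
  obtains Q R where "Q \<in> EG.L" "R \<in> GF.L" "\<And>k. k \<in> B \<Longrightarrow> op_norm E F (R \<circ> Q) k (S k) = \<infinity>"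
proof -
  \<comment> \<open>\<open>prod_decode\<close> enumerates the pairs \<open>(k, n)\<close>. Levels
    outside \<open>B\<close> impose no condition, so the whole space stands there.\<close>
  define U where "U = (\<lambda>j. case prod_decode j of
    (k, n) \<Rightarrow> if k \<in> B then exceeding k (S k) (real n) else factors)"
  have "\<exists>z\<in>factors. \<forall>j. z \<in> U j"
  proof (rule factors_baire)
    show "U j \<subseteq> factors" for j
      by (auto simp: U_def exceeding_def split: prod.splits)
    show "\<exists>m. \<exists>\<epsilon>>0. \<forall>z'\<in>factors. pdist m z z' < \<epsilon> \<longrightarrow> z' \<in> U j" if "z \<in> U j" for j z
    proof -
      obtain k n where j: "prod_decode j = (k, n)" by (cases "prod_decode j")
      show ?thesis
        using that exceeding_open[of k z "S k" "real n"] assms[of k]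
        by (cases "k \<in> B") (auto simp: U_def j intro: exI[of _ 1])
    qed
    show "\<exists>z'\<in>U j. pdist m z z' < \<epsilon>" if z: "z \<in> factors" and \<epsilon>: "0 < \<epsilon>" for j z m \<epsilon>
    proof -
      obtain k n where j: "prod_decode j = (k, n)" by (cases "prod_decode j")
      show ?thesis
      proof (cases "k \<in> B")
        case True
        then have "\<exists>z'\<in>exceeding k (S k) (real n). pdist m z z' < \<epsilon>"
          using bounded_productI[OF _ \<epsilon> _ z, of k "real n" m "S k"] assms[OF True] by auto
        with True j show ?thesis by (simp add: U_def)
      next
        case False
        have "pdist m z z = 0" by (auto simp: pdist_def EG.opn_zero GF.opn_zero)
        with False j z \<epsilon> show ?thesis by (auto simp: U_def intro!: bexI[of _ z])
      qed
    qed
  qed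
  then obtain z where z: "z \<in> factors" "\<And>j. z \<in> U j" by blast
  have "op_norm E F (snd z \<circ> fst z) k (S k) = \<infinity>" if "k \<in> B" for k
  proof (rule ccontr)
    assume "op_norm E F (snd z \<circ> fst z) k (S k) \<noteq> \<infinity>"
    then obtain n where n: "op_norm E F (snd z \<circ> fst z) k (S k) < of_nat n"
      using ennreal_Ex_less_of_nat[of "op_norm E F (snd z \<circ> fst z) k (S k)"]
      by (auto simp: less_top)
    have "z \<in> exceeding k (S k) (real n)"
      using z(2)[of "prod_encode (k, n)"] that by (simp add: U_def)
    then obtain x where x: "snorm E (S k) x \<le> 1" "real n < snorm F k (snd z (fst z x))"
      by (auto simp: exceeding_def)
    then have "ennreal (snorm F k ((snd z \<circ> fst z) x)) \<le> op_norm E F (snd z \<circ> fst z) k (S k)"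
      unfolding op_norm_def by (intro SUP_upper) simp
    also note n
    finally show False using x(2) by (simp add: ennreal_of_nat_eq_real_of_nat ennreal_less_iff)
  qed
  with z(1) that show thesis by (auto simp: factors_def mem_Times_iff)
qed

end

section \<open>Equivalence of tameness and the uniform bound\<close>

text \<open>Chooses one admissible index per level; the function \<phi> common to two given factors
  is assembled from such choices.\<close>

lemma cont_ops_indices:
  assumes "frechet_space E" "frechet_space F" "T \<in> cont_ops E F"
  obtains f where "\<And>k. 1 \<le> k \<Longrightarrow> 1 \<le> f k \<and> op_norm E F T k (f k) < \<infinity>"
proof -
  interpret frechet_pair E F using assms by unfold_locales
  show thesis using assms(3) that unfolding cont_ops_iff by metis
qed

theorem theorem4p2:
  fixes E :: "('k::real_normed_field, 'e::ab_group_add) graded_space"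
    and F :: "('k, 'f::ab_group_add) graded_space"
    and G :: "('k, 'g::ab_group_add) graded_space"
  assumes "frechet_space E" and "frechet_space F" and "frechet_space G"
  shows "tame_factorization E G F \<longleftrightarrow>
    (\<exists>S \<in> {1::nat..} \<rightarrow> {1::nat..}. mono_on {1..} S \<and>
      (\<forall>\<phi> \<in> {1::nat..} \<rightarrow> {1::nat..}. \<exists>k0\<ge>1. \<forall>k\<ge>k0. \<exists>qk\<ge>1. \<exists>C>0::real.
        \<forall>Q\<in>cont_ops_bounded \<phi> E G. \<forall>R\<in>cont_ops_bounded \<phi> G F.
          op_norm E F (R \<circ> Q) k (S k)
            \<le> ennreal C * (MAX q\<in>{1..qk}. op_norm G F R q (\<phi> q))
                        * (MAX q\<in>{1..qk}. op_norm E G Q q (\<phi> q))))"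
proof -
  interpret EG: frechet_pair E G using assms by unfold_locales
  interpret GF: frechet_pair G F using assms by unfold_locales
  interpret EF: frechet_pair E F using assms by unfold_locales
  \<comment> \<open>Both sides ask for an \<open>S\<close> under the same side conditions, so the
    equivalence is shown for each fixed \<open>S\<close>.\<close>
  have "(\<forall>T\<in>cont_ops_through G E F. \<exists>k0\<ge>1. \<forall>k\<ge>k0. cont_char E F T k \<le> S k) \<longleftrightarrow>
    (\<forall>\<phi> \<in> {1::nat..} \<rightarrow> {1::nat..}. \<exists>k0\<ge>1. \<forall>k\<ge>k0. \<exists>qk\<ge>1. \<exists>C>0::real.
        \<forall>Q\<in>cont_ops_bounded \<phi> E G. \<forall>R\<in>cont_ops_bounded \<phi> G F.
          op_norm E F (R \<circ> Q) k (S k)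
            \<le> ennreal C * (MAX q\<in>{1..qk}. op_norm G F R q (\<phi> q))
                        * (MAX q\<in>{1..qk}. op_norm E G Q q (\<phi> q)))" (is "?tame \<longleftrightarrow> ?bound")
    if S: "S \<in> {1..} \<rightarrow> {1..}" for S :: "nat \<Rightarrow> nat"
  proof
    assume tame: ?tame
    show ?bound
    proof
      fix \<phi> :: "nat \<Rightarrow> nat" assume phi: "\<phi> \<in> {1..} \<rightarrow> {1..}"
      interpret frechet_triple E G F \<phi> using phi by unfold_locales
      \<comment> \<open>The levels where the bound fails. All of them have to lie below the
        \<open>k0\<close> that tameness supplies for the one product
        \<open>R \<circ> Q\<close>.\<close>
      define B where "B = {k. 1 \<le> k \<and> \<not> bounded_product k (S k)}"
      obtain Q R where QR: "Q \<in> EG.L" "R \<in> GF.L"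
        and inf: "\<And>k. k \<in> B \<Longrightarrow> op_norm E F (R \<circ> Q) k (S k) = \<infinity>"
        using unbounded_product[of B S] by (auto simp: B_def)
      have Q: "Q \<in> cont_ops E G" and R: "R \<in> cont_ops G F"
        using QR by (auto simp: cont_ops_bounded_def)
      then have T: "R \<circ> Q \<in> cont_ops E F"
        using lin_comp continuous_map_compose by (auto simp: cont_ops_def)
      then have "R \<circ> Q \<in> cont_ops_through G E F"
        using Q R by (auto simp: cont_ops_through_def)
      then obtain k0 where k0: "k0 \<ge> 1" "\<And>k. k \<ge> k0 \<Longrightarrow> cont_char E F (R \<circ> Q) k \<le> S k"
        using tame by blast
      have "bounded_product k (S k)" if k: "k \<ge> k0" for k
      proof -
        have k1: "1 \<le> k" "1 \<le> S k" using k k0(1) S by auto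
        then have "op_norm E F (R \<circ> Q) k (S k) < \<infinity>"
          using EF.cont_char_le_iff[OF T] k0(2)[OF k] by simp
        then show ?thesis using inf[of k] k1 by (cases "k \<in> B") (auto simp: B_def)
      qed
      with k0(1) show "\<exists>k0\<ge>1. \<forall>k\<ge>k0. \<exists>qk\<ge>1. \<exists>C>0::real.
        \<forall>Q\<in>cont_ops_bounded \<phi> E G. \<forall>R\<in>cont_ops_bounded \<phi> G F.
          op_norm E F (R \<circ> Q) k (S k)
            \<le> ennreal C * (MAX q\<in>{1..qk}. op_norm G F R q (\<phi> q))
                        * (MAX q\<in>{1..qk}. op_norm E G Q q (\<phi> q))"
        unfolding bounded_product_def by blast
    qed
  next
    assume bound: ?bound
    show ?tame
    proof
      fix T assume "T \<in> cont_ops_through G E F"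
      then obtain Q R where Q: "Q \<in> cont_ops E G" and R: "R \<in> cont_ops G F"
        and T: "T \<in> cont_ops E F" "T = R \<circ> Q"
        by (auto simp: cont_ops_through_def)
      obtain f where f: "\<And>k. 1 \<le> k \<Longrightarrow> 1 \<le> f k \<and> op_norm E G Q k (f k) < \<infinity>"
        using cont_ops_indices[OF assms(1,3) Q] by blast
      obtain g where g: "\<And>k. 1 \<le> k \<Longrightarrow> 1 \<le> g k \<and> op_norm G F R k (g k) < \<infinity>"
        using cont_ops_indices[OF assms(3,2) R] by blast
      \<comment> \<open>Norms decrease in the second index, so the maximum is admissible for
        \<open>Q\<close> and \<open>R\<close> simultaneously.\<close>
      define \<phi> where "\<phi> k = max (f k) (g k)" for k
      have phi: "\<phi> \<in> {1..} \<rightarrow> {1..}" using f by (force simp: \<phi>_def)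
      have finQ: "op_norm E G Q k (\<phi> k) < \<infinity>" and finR: "op_norm G F R k (\<phi> k) < \<infinity>"
        if "1 \<le> k" for k
        using f[OF that] g[OF that] EG.op_norm_antimono[of "f k" "\<phi> k" Q k]
          GF.op_norm_antimono[of "g k" "\<phi> k" R k] by (auto simp: \<phi>_def)
      have QR: "Q \<in> cont_ops_bounded \<phi> E G" "R \<in> cont_ops_bounded \<phi> G F"
        using Q R finQ finR by (auto simp: cont_ops_bounded_def)
      obtain k0 where k0: "k0 \<ge> 1" and le: "\<And>k. k \<ge> k0 \<Longrightarrow> \<exists>qk\<ge>1. \<exists>C>0::real.
          op_norm E F T k (S k) \<le> ennreal C * (MAX q\<in>{1..qk}. op_norm G F R q (\<phi> q))
            * (MAX q\<in>{1..qk}. op_norm E G Q q (\<phi> q))"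
        using bound[rule_format, OF phi] QR unfolding T(2) by meson
      have "cont_char E F T k \<le> S k" if k: "k \<ge> k0" for k
      proof -
        obtain q C where q: "q \<ge> 1" and le_q: "op_norm E F T k (S k)
            \<le> ennreal C * (MAX q\<in>{1..q}. op_norm G F R q (\<phi> q))
              * (MAX q\<in>{1..q}. op_norm E G Q q (\<phi> q))"
          using le[OF k] by blast
        \<comment> \<open>A maximum over a finite nonempty range of finite norms is finite, so the
          right-hand side of the bound is finite.\<close>
        have "(MAX q\<in>{1..q}. op_norm G F R q (\<phi> q)) < \<infinity>"
          "(MAX q\<in>{1..q}. op_norm E G Q q (\<phi> q)) < \<infinity>"
          using q finQ finR by (subst Max_less_iff; auto)+
        then have "op_norm E F T k (S k) < \<infinity>"
          using le_q by (auto simp: ennreal_mult_less_top intro: le_less_trans)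
        then show ?thesis
          using EF.cont_char_le_iff[OF T(1), of k "S k"] k k0 S by (auto simp: Pi_iff)
      qed
      with k0 show "\<exists>k0\<ge>1. \<forall>k\<ge>k0. cont_char E F T k \<le> S k" by blast
    qed
  qed
  then show ?thesis
    unfolding tame_factorization_def by (intro bex_cong refl conj_cong) auto
qed

end
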